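(* Let $s,k,n$ be integers and $m\ge 1$. Let $p,q,r,a,b,c$ be real numbers with $c\neq 0$, let $(P_n)_{n\in\mathbb{Z}}=\mathcal{P}(x)(p,q,r;a,b,c)$, $(U_n)_{n\in\mathbb{Z}}=\mathcal{P}(x)(0,0,1;a,b,c)$, and $\Delta_{\mathcal{P}}=(q^2-apq)x^2+(2qr-apr-bpq)x+(r^2-bpr-cp^2)$. Let $d_1,\dots,d_m$ and $e_1,\dots,e_m$ be integers. Then \[ \det\Big(\Big[\prod_{f=j+1}^m P_{s+k(n+i+d_f)}\prod_{g=1}^j P_{s+k(n+i+e_g)}\Big]_{0\le i,j\le m}\Big) = (-\Delta_{\mathcal{P}})^{\binom{m+1}{2}}(-c)^{(s+kn)\binom{m+1}{2}+k\binom{m+1}{3}}\prod_{l=1}^m U_{kl}^{m+1-l}\cdot\prod_{1\le i\le j\le m}(-c)^{kd_j}U_{k(e_i-d_j)}. \]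
   Context: For real numbers $p,q,r,a,b,c$ with $c\neq 0$, $\mathcal{P}(x)(p,q,r;a,b,c)=(P_n)_{n\in\mathbb{Z}}$ denotes the sequence of polynomials in $x$ defined by $P_0=p$, $P_1=qx+r$, $P_{n+2}=(ax+b)P_{n+1}+cP_n$ for $n\ge 0$, and for $n<0$ by $P_n=-\frac{ax+b}{c}P_{n+1}+\frac{1}{c}P_{n+2}$; so $U_0=0$, $U_1=1$. $[M_{i,j}]_{0\le i,j\le m}$ is the $(m+1)\times(m+1)$ matrix with entry $M_{i,j}$ in row $i$, column $j$; empty products equal $1$. *)

theory Defs
  imports
    "HOL-Computational_Algebra.Polynomial"
    "Jordan_Normal_Form.Determinant"
begin

text \<open>
  The two-sided sequence with parameters \<open>(p, q, r; a, b, c)\<close> as polynomials in \<open>x\<close>;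
  note that \<open>[:v, u:]\<close> is the polynomial \<open>u x + v\<close>. It is meant for \<open>c \<noteq> 0\<close>.
\<close>

function poly_seq :: "real \<Rightarrow> real \<Rightarrow> real \<Rightarrow> real \<Rightarrow> real \<Rightarrow> real \<Rightarrow> int \<Rightarrow> real poly" where
  "poly_seq p q r a b c n =
     (if n = 0 then [:p:]
      else if n = 1 then [:r, q:]
      else if n > 1 then
        [:b, a:] * poly_seq p q r a b c (n - 1) + [:c:] * poly_seq p q r a b c (n - 2)
      else
        - ([:b / c, a / c:] * poly_seq p q r a b c (n + 1))
          + [:1 / c:] * poly_seq p q r a b c (n + 2))"
  by auto
termination
  by (relation "measure (\<lambda>(p, q, r, a, b, c, n). nat \<bar>2 * n - 1\<bar>)") auto

declare poly_seq.simps [simp del]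

lemma poly_seq_0: "poly_seq p q r a b c 0 = [:p:]"
  by (simp add: poly_seq.simps)

lemma poly_seq_1: "poly_seq p q r a b c 1 = [:r, q:]"
  by (simp add: poly_seq.simps)

lemma poly_seq_nonneg:
  assumes "n \<ge> 0"
  shows "poly_seq p q r a b c (n + 2) =
    [:b, a:] * poly_seq p q r a b c (n + 1) + [:c:] * poly_seq p q r a b c n"
  using assms by (subst poly_seq.simps) (simp add: add.commute)

lemma poly_seq_neg:
  assumes "n < 0"
  shows "poly_seq p q r a b c n =
    - ([:b / c, a / c:] * poly_seq p q r a b c (n + 1)) + [:1 / c:] * poly_seq p q r a b c (n + 2)"
  using assms by (subst poly_seq.simps) simp

definition poly_seq_Delta :: "real \<Rightarrow> real \<Rightarrow> real \<Rightarrow> real \<Rightarrow> real \<Rightarrow> real \<Rightarrow> real poly" where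
  "poly_seq_Delta p q r a b c =
     [:r\<^sup>2 - b * p * r - c * p\<^sup>2, 2 * q * r - a * p * r - b * p * q, q\<^sup>2 - a * p * q:]"

end

theory Submission
  imports Defs
begin

text \<open>
  Since \<open>P\<^bsub>N+t\<^esub> = P\<^bsub>N+1\<^esub> U\<^bsub>t\<^esub> + c P\<^bsub>N\<^esub> U\<^bsub>t-1\<^esub>\<close>, every factor in row \<open>i\<close> is a linear form
  evaluated at the point \<open>(x\<^sub>i, y\<^sub>i) = (P\<^bsub>N\<^esub>, P\<^bsub>N+1\<^esub>)\<close> with \<open>N = s + k(n + i)\<close>. For arbitrary linear
  forms \<open>L\<^sub>f\<close>, \<open>M\<^sub>g\<close>, a homogeneous version of Krattenthaler's determinant lemma evaluates
  \<open>det [\<Prod>\<^bsub>f>j\<^esub> L\<^sub>f(x\<^sub>i, y\<^sub>i) \<Prod>\<^bsub>g\<le>j\<^esub> M\<^sub>g(x\<^sub>i, y\<^sub>i)]\<close> as a product of \<open>2 \<times> 2\<close> determinants of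
  points and of coefficient vectors, and each of these is a Casorati determinant
  \<open>P\<^bsub>M\<^esub> P\<^bsub>N+1\<^esub> - P\<^bsub>N\<^esub> P\<^bsub>M+1\<^esub> = -\<Delta> (-c)\<^bsup>M\<^esup> U\<^bsub>N-M\<^esub>\<close>.
\<close>

section \<open>Two-sided linear recurrences of order two and the addition formula\<close>

definition linear_rec :: "'a::comm_ring_1 \<Rightarrow> 'a \<Rightarrow> (int \<Rightarrow> 'a) \<Rightarrow> bool" where
  "linear_rec A C F \<longleftrightarrow> (\<forall>t. F (t + 2) = A * F (t + 1) + C * F t)"

lemma linear_recD: "linear_rec A C F \<Longrightarrow> F (t + 2) = A * F (t + 1) + C * F t"
  by (simp add: linear_rec_def)

text \<open>Induction in both directions on two consecutive values; the downward step cancels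
  \<open>C\<close>, whence \<open>C \<noteq> 0\<close> over an integral domain.\<close>

lemma linear_rec_unique:
  fixes C :: "'a::idom"
  assumes F: "linear_rec A C F" and G: "linear_rec A C G" and C: "C \<noteq> 0"
    and "F 0 = G 0" "F 1 = G 1"
  shows "F t = G t"
proof -
  have "F t = G t \<and> F (t + 1) = G (t + 1)"
  proof (induction t rule: int_induct[where k = 0])
    case base
    then show ?case using assms by simp
  next
    case (step1 i)
    then show ?case using linear_recD[OF F, of i] linear_recD[OF G, of i] by (simp add: add.assoc)
  next
    case (step2 i)
    then show ?case using linear_recD[OF F, of "i - 1"] linear_recD[OF G, of "i - 1"] C
      by (simp add: add.commute)
  qed
  then show ?thesis ..
qed

lemma linear_rec_poly_seq:
  assumes "c \<noteq> 0"
  shows "linear_rec [:b, a:] [:c:] (poly_seq p q r a b c)"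
  unfolding linear_rec_def
proof
  fix t :: int
  let ?P = "poly_seq p q r a b c"
  show "?P (t + 2) = [:b, a:] * ?P (t + 1) + [:c:] * ?P t"
  proof (cases "t \<ge> 0")
    case True
    then show ?thesis by (rule poly_seq_nonneg)
  next
    case False
    then have "[:c:] * ?P t = - ([:c:] * [:b / c, a / c:] * ?P (t + 1)) + [:c:] * [:1 / c:] * ?P (t + 2)"
      by (subst poly_seq_neg) (simp_all only: not_le algebra_simps)
    also have "[:c:] * [:b / c, a / c:] = [:b, a:]"
      using assms by simp
    also have "[:c:] * [:1 / c:] = 1"
      using assms by (simp add: one_pCons)
    finally show ?thesis by simp
  qed
qed


lemma linear_rec_shift: "linear_rec A C F \<Longrightarrow> linear_rec A C (\<lambda>t. F (N + t))"
  by (simp add: linear_rec_def add.assoc [symmetric])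

lemma linear_rec_cmult: "linear_rec A C F \<Longrightarrow> linear_rec A C (\<lambda>t. z * F t)"
  by (simp add: linear_rec_def algebra_simps)

lemma linear_rec_add:
  "linear_rec A C F \<Longrightarrow> linear_rec A C G \<Longrightarrow> linear_rec A C (\<lambda>t. F t + G t)"
  by (simp add: linear_rec_def algebra_simps)

lemma linear_rec_diff:
  "linear_rec A C F \<Longrightarrow> linear_rec A C G \<Longrightarrow> linear_rec A C (\<lambda>t. F t - G t)"
  by (simp add: linear_rec_def algebra_simps)

lemma poly_seq_add:
  fixes p q r a b c :: real
  assumes "c \<noteq> 0"
  defines "P \<equiv> poly_seq p q r a b c" and "U \<equiv> poly_seq 0 0 1 a b c"
  shows "P (N + t) = P (N + 1) * U t + P N * ([:c:] * U (t - 1))"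
proof (rule linear_rec_unique[where F = "\<lambda>t. P (N + t)" and
        G = "\<lambda>t. P (N + 1) * U t + P N * ([:c:] * U (t - 1))"])
  have P: "linear_rec [:b, a:] [:c:] P" and U: "linear_rec [:b, a:] [:c:] U"
    unfolding P_def U_def by (intro linear_rec_poly_seq assms)+
  show "linear_rec [:b, a:] [:c:] (\<lambda>t. P (N + t))"
    by (rule linear_rec_shift[OF P])
  show "linear_rec [:b, a:] [:c:] (\<lambda>t. P (N + 1) * U t + P N * ([:c:] * U (t - 1)))"
    using linear_rec_shift[OF U, of "-1"]
    by (intro linear_rec_add linear_rec_cmult U) simp
  have U01: "U 0 = 0" "U 1 = 1"
    by (simp_all add: U_def poly_seq_0 poly_seq_1 one_pCons)
  \<comment> \<open>The recurrence at \<open>-1\<close> with \<open>U 0 = 0\<close> and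
    \<open>U 1 = 1\<close> gives \<open>[:c:] * U (- 1) = 1\<close>.\<close>
  show "P (N + 0) = P (N + 1) * U 0 + P N * ([:c:] * U (0 - 1))"
    using linear_recD[OF U, of "-1"] U01 by simp
  show "P (N + 1) = P (N + 1) * U 1 + P N * ([:c:] * U (1 - 1))"
    using U01 by simp
qed (use assms in simp)

section \<open>Casorati determinants\<close>

text \<open>With \<open>P 2\<close> expanded by the recurrence this is
  \<open>(P 1)\<^sup>2 - P 0 * P 2\<close>, a Casorati determinant at index 0 up to sign.\<close>

lemma poly_seq_Delta_eq:
  "poly_seq_Delta p q r a b c = [:r, q:]\<^sup>2 - [:p:] * [:r, q:] * [:b, a:] - [:c:] * [:p:]\<^sup>2"
  by (simp add: poly_seq_Delta_def power2_eq_square algebra_simps)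

text \<open>Each step of the recurrence multiplies the left side by \<open>- c\<close>, the
  determinant of the companion matrix.\<close>

lemma poly_seq_casorati_step:
  fixes p q r a b c :: real
  assumes c: "c \<noteq> 0"
  defines "P \<equiv> poly_seq p q r a b c"
  shows "P N * P (N + 2) - (P (N + 1))\<^sup>2 = - poly_seq_Delta p q r a b c * [:(- c) powi N:]"
proof -
  have P: "P (t + 2) = [:b, a:] * P (t + 1) + [:c:] * P t" for t
    unfolding P_def by (intro linear_recD linear_rec_poly_seq assms)
  have ring: "v * (A * (A * v + C * u) + C * v) - (A * v + C * u)\<^sup>2 =
      - C * (u * (A * v + C * u) - v\<^sup>2)" for A C u v :: "real poly"
    by (simp add: power2_eq_square algebra_simps)
  define W where "W t = P t * P (t + 2) - (P (t + 1))\<^sup>2" for t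
  have W: "W (t + 1) = [:- c:] * W t" for t
  proof -
    have "W (t + 1) = P (t + 1) * ([:b, a:] * P (t + 2) + [:c:] * P (t + 1)) - (P (t + 2))\<^sup>2"
      using P[of "t + 1"] by (simp only: W_def add.assoc) simp
    also have "\<dots> = - [:c:] * W t"
      unfolding W_def P[of t] by (rule ring)
    finally show ?thesis by simp
  qed
  have h: "[:(- c) powi (t + 1):] = [:- c:] * [:(- c) powi t:]" for t
    using c by (simp add: power_int_add)
  have "W N = - poly_seq_Delta p q r a b c * [:(- c) powi N:]"
  proof (induction N rule: int_induct[where k = 0])
    case base
    have "W 0 = - poly_seq_Delta p q r a b c"
      using P[of 0] unfolding W_def poly_seq_Delta_eq
      by (simp only: P_def poly_seq_0 poly_seq_1 add_0) (simp add: power2_eq_square algebra_simps)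
    then show ?case by (simp add: one_pCons [symmetric])
  next
    case (step1 i)
    then show ?case unfolding W h by (simp only: mult.left_commute)
  next
    case (step2 i)
    have "[:- c:] * W (i - 1) = [:- c:] * (- poly_seq_Delta p q r a b c * [:(- c) powi (i - 1):])"
      using step2 W[of "i - 1"] h[of "i - 1"] by (simp only: diff_add_cancel mult.left_commute)
    then show ?case using c by (subst (asm) mult_left_cancel) simp_all
  qed
  then show ?thesis by (simp only: W_def)
qed

text \<open>For fixed \<open>M\<close> both sides satisfy the recurrence in \<open>N - M\<close>;
  they vanish at 0, and at 1 they agree by the previous lemma.\<close>

lemma poly_seq_casorati:
  fixes p q r a b c :: real
  assumes c: "c \<noteq> 0"
  defines "P \<equiv> poly_seq p q r a b c" and "U \<equiv> poly_seq 0 0 1 a b c"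
  shows "P M * P (N + 1) - P N * P (M + 1) =
    - poly_seq_Delta p q r a b c * [:(- c) powi M:] * U (N - M)"
proof -
  have P: "linear_rec [:b, a:] [:c:] P" and U: "linear_rec [:b, a:] [:c:] U"
    unfolding P_def U_def by (intro linear_rec_poly_seq assms)+
  define K where "K = - poly_seq_Delta p q r a b c * [:(- c) powi M:]"
  have "P M * P (M + 1 + t) - P (M + 1) * P (M + t) = K * U t" for t
  proof (rule linear_rec_unique[where F = "\<lambda>t. P M * P (M + 1 + t) - P (M + 1) * P (M + t)" and
        G = "\<lambda>t. K * U t"])
    show "linear_rec [:b, a:] [:c:] (\<lambda>t. P M * P (M + 1 + t) - P (M + 1) * P (M + t))"
      by (intro linear_rec_diff linear_rec_cmult linear_rec_shift P)
    show "linear_rec [:b, a:] [:c:] (\<lambda>t. K * U t)"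
      by (intro linear_rec_cmult U)
    show "P M * P (M + 1 + 0) - P (M + 1) * P (M + 0) = K * U 0"
      by (simp add: U_def poly_seq_0)
    show "P M * P (M + 1 + 1) - P (M + 1) * P (M + 1) = K * U 1"
      using poly_seq_casorati_step[OF c, of p q r a b M]
      by (simp add: K_def P_def U_def poly_seq_1 one_pCons [symmetric] power2_eq_square add.assoc)
  qed (use c in simp)
  from this[of "N - M"] show ?thesis by (simp add: K_def mult.commute algebra_simps)
qed

section \<open>Determinants of products of linear forms\<close>

lemma det_scale_rows_cols:
  fixes A :: "nat \<Rightarrow> nat \<Rightarrow> 'a::comm_ring_1"
  shows "det (mat n n (\<lambda>(i, j). u i * v j * A i j)) =
    (\<Prod>i<n. u i) * (\<Prod>j<n. v j) * det (mat n n (\<lambda>(i, j). A i j))"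
proof -
  have "signof \<pi> * (\<Prod>i = 0..<n. u i * v (\<pi> i) * A i (\<pi> i)) =
      (\<Prod>i<n. u i) * (\<Prod>j<n. v j) * (signof \<pi> * (\<Prod>i = 0..<n. A i (\<pi> i)))"
    if "\<pi> permutes {0..<n}" for \<pi>
  proof -
    have "(\<Prod>i = 0..<n. v (\<pi> i)) = (\<Prod>i = 0..<n. v i)"
      using prod.permute[OF that, of v] by (simp add: o_def)
    then show ?thesis
      by (simp add: prod.distrib lessThan_atLeast0 mult_ac)
  qed
  then show ?thesis
    by (subst (1 2) det_def'[where n = n])
      (auto simp: sum_distrib_left permutes_in_image intro!: sum.cong prod.cong)
qed

text \<open>
  Adjacent columns share all factors but one, so a combination of them that vanishes in row \<open>0\<close>
  splits off \<open>(x\<^sub>i y\<^sub>0 - x\<^sub>0 y\<^sub>i) (a\<^sub>j b'\<^sub>j - a'\<^sub>j b\<^sub>j)\<close> and leaves the matrix of the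
  next smaller size, with the forms \<open>L\<close> shifted by one. The column operations multiply the
  determinant by the product of the \<open>M\<^sub>g(x\<^sub>0, y\<^sub>0)\<close>, which must be cancelled.
\<close>

lemma det_linear_forms_generic:
  fixes x y a b a' b' :: "nat \<Rightarrow> 'a::idom"
  assumes "\<And>i g. x i * a' g + y i * b' g \<noteq> 0"
  shows "det (mat (Suc m) (Suc m) (\<lambda>(i, j).
      (\<Prod>f = j..<m. x i * a f + y i * b f) * (\<Prod>g<j. x i * a' g + y i * b' g))) =
    (\<Prod>j\<le>m. \<Prod>i<j. x i * y j - x j * y i) * (\<Prod>j<m. \<Prod>i\<le>j. a j * b' i - a' i * b j)"
  using assms
\<comment> \<open>\<open>a'\<close> and \<open>b'\<close> stay fixed: the smaller matrix loses the
  point with index 0 and the form \<open>L 0\<close>, but its \<open>M\<close> keep their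
  indices.\<close>
proof (induction m arbitrary: x y a b)
  case 0
  then show ?case by (simp add: det_single)
next
  case (Suc m)
  define L where "L f i = x i * a f + y i * b f" for f i
  define M where "M g i = x i * a' g + y i * b' g" for g i
  define \<kappa> where "\<kappa> j = a j * b' j - a' j * b j" for j
  define F where "F j i = (\<Prod>f = j..<Suc m. L f i) * (\<Prod>g<j. M g i)" for j i
  \<comment> \<open>The common part of \<open>F j\<close> and \<open>F (Suc j)\<close>; without row
    0 these are the columns of the smaller matrix.\<close>
  define Q where "Q j i = (\<Prod>f = j..<m. L (Suc f) i) * (\<Prod>g<j. M g i)" for j i
  let ?n = "Suc (Suc m)"
  define G where "G = mat ?n ?n (\<lambda>(i, j). F j i)"
  \<comment> \<open>Right multiplication by \<open>B\<close> replaces column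
    \<open>j < Suc m\<close> by \<open>M j 0\<close> times itself minus \<open>L j 0\<close> times
    the next one, and keeps the last.\<close>
  define B where "B = mat ?n ?n (\<lambda>(i, j). if i = j then (if j < Suc m then M j 0 else 1)
      else if i = Suc j then - L j 0 else 0)"
  define H where "H = mat ?n ?n (\<lambda>(i, j). if j < Suc m
      then (x i * y 0 - x 0 * y i) * \<kappa> j * Q j i else F j i)"
  have carrier: "G \<in> carrier_mat ?n ?n" "B \<in> carrier_mat ?n ?n" "H \<in> carrier_mat ?n ?n"
    by (simp_all add: G_def B_def H_def)
  have F_Q: "F j i = L j i * Q j i" "F (Suc j) i = M j i * Q j i" if "j < Suc m" for i j
    using that unfolding F_def Q_def
    by (simp_all only: prod.atLeast_Suc_lessThan prod.shift_bounds_Suc_ivl lessThan_Suc)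
      (simp_all add: mult_ac)
  have col: "F j i * M j 0 - F (Suc j) i * L j 0 = (x i * y 0 - x 0 * y i) * \<kappa> j * Q j i"
    if "j < Suc m" for i j
    unfolding F_Q[OF that] L_def M_def \<kappa>_def by (simp add: algebra_simps)
  have "G * B = H"
  proof (rule eq_matI)
    fix i j assume "i < dim_row H" "j < dim_col H"
    then have i: "i < ?n" and j: "j < ?n" by (simp_all add: H_def)
    have "(G * B) $$ (i, j) = (\<Sum>l<?n. F l i * B $$ (l, j))"
      using i j by (simp add: G_def B_def scalar_prod_def lessThan_atLeast0)
    also have "\<dots> = H $$ (i, j)"
    proof (cases "j < Suc m")
      case True
      have "(\<Sum>l<?n. F l i * B $$ (l, j)) = (\<Sum>l\<in>{j, Suc j}. F l i * B $$ (l, j))"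
        using True by (intro sum.mono_neutral_right) (auto simp: B_def)
      also have "\<dots> = F j i * M j 0 - F (Suc j) i * L j 0"
        using True by (simp add: B_def)
      finally show ?thesis using True i col[OF True] by (simp add: H_def)
    next
      case False
      then have "j = Suc m" using j by simp
      have "(\<Sum>l<?n. F l i * B $$ (l, j)) = (\<Sum>l\<in>{j}. F l i * B $$ (l, j))"
        using \<open>j = Suc m\<close> by (intro sum.mono_neutral_right) (auto simp: B_def)
      then show ?thesis using i \<open>j = Suc m\<close> by (simp add: B_def H_def)
    qed
    finally show "(G * B) $$ (i, j) = H $$ (i, j)" .
  qed (simp_all add: G_def B_def H_def)
  then have GB: "det G * det B = det H"
    using det_mult[OF carrier(1,2)] by simp
  have "det B = (\<Prod>g<Suc m. M g 0)"
    by (subst det_lower_triangular[OF _ carrier(2)])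
      (auto simp: B_def prod_list_diag_prod lessThan_atLeast0)
  \<comment> \<open>The \<open>L\<close>-product in \<open>F (Suc m)\<close> is empty, so
    \<open>det B\<close> equals the last entry of row 0 of \<open>H\<close> and cancels against
    it.\<close>
  then have detB: "det B = F (Suc m) 0"
    by (simp add: F_def)
  have "det H = (\<Sum>j<?n. H $$ (0, j) * cofactor H 0 j)"
    by (rule laplace_expansion_row[OF carrier(3)]) simp
  also have "\<dots> = (\<Sum>j\<in>{Suc m}. H $$ (0, j) * cofactor H 0 j)"
    by (intro sum.mono_neutral_right) (auto simp: H_def)
  also have "\<dots> = F (Suc m) 0 * ((- 1) ^ Suc m * det (mat_delete H 0 (Suc m)))"
    by (simp add: H_def cofactor_def)
  also have "mat_delete H 0 (Suc m) = mat (Suc m) (Suc m)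
      (\<lambda>(i, j). (x (Suc i) * y 0 - x 0 * y (Suc i)) * \<kappa> j * Q j (Suc i))"
    by (rule eq_matI) (auto simp: mat_delete_def H_def)
  also have "(- 1) ^ Suc m * det \<dots> = (\<Prod>i<Suc m. x 0 * y (Suc i) - x (Suc i) * y 0) *
      (\<Prod>j<Suc m. \<kappa> j) * det (mat (Suc m) (Suc m) (\<lambda>(i, j). Q j (Suc i)))"
  proof -
    \<comment> \<open>The \<open>m + 1\<close> row factors absorb the cofactor sign by swapping
      their two terms.\<close>
    have "(- 1) ^ Suc m * (\<Prod>i<Suc m. x (Suc i) * y 0 - x 0 * y (Suc i)) =
        (\<Prod>i<Suc m. x 0 * y (Suc i) - x (Suc i) * y 0)"
      using prod.distrib[of "\<lambda>_. - 1" "\<lambda>i. x (Suc i) * y 0 - x 0 * y (Suc i)" "{..<Suc m}"]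
      by (simp only: prod_constant card_lessThan) simp
    then show ?thesis
      by (subst det_scale_rows_cols) (simp only: mult.assoc [symmetric])
  qed
  also have "det (mat (Suc m) (Suc m) (\<lambda>(i, j). Q j (Suc i))) =
      (\<Prod>j\<le>m. \<Prod>i<j. x (Suc i) * y (Suc j) - x (Suc j) * y (Suc i)) *
      (\<Prod>j<m. \<Prod>i\<le>j. a (Suc j) * b' i - a' i * b (Suc j))"
    unfolding Q_def L_def M_def by (rule Suc.IH) (rule Suc.prems)
  finally have "det G = (\<Prod>i<Suc m. x 0 * y (Suc i) - x (Suc i) * y 0) * (\<Prod>j<Suc m. \<kappa> j) *
      ((\<Prod>j\<le>m. \<Prod>i<j. x (Suc i) * y (Suc j) - x (Suc j) * y (Suc i)) *
      (\<Prod>j<m. \<Prod>i\<le>j. a (Suc j) * b' i - a' i * b (Suc j)))"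
    using GB Suc.prems unfolding detB by (simp add: F_def M_def mult.commute[of "det G"])
  also have "\<dots> = ((\<Prod>j\<le>m. x 0 * y (Suc j) - x (Suc j) * y 0) *
      (\<Prod>j\<le>m. \<Prod>i<j. x (Suc i) * y (Suc j) - x (Suc j) * y (Suc i))) *
      ((\<Prod>j<m. \<Prod>i\<le>j. a (Suc j) * b' i - a' i * b (Suc j)) * (\<Prod>j<Suc m. \<kappa> j))"
    by (simp only: lessThan_Suc_atMost mult_ac)
  also have "(\<Prod>j\<le>m. x 0 * y (Suc j) - x (Suc j) * y 0) *
      (\<Prod>j\<le>m. \<Prod>i<j. x (Suc i) * y (Suc j) - x (Suc j) * y (Suc i)) =
      (\<Prod>j\<le>Suc m. \<Prod>i<j. x i * y j - x j * y i)"
    by (simp only: prod.atMost_Suc_shift prod.lessThan_Suc_shift prod.distrib) simp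
  also have "(\<Prod>j<m. \<Prod>i\<le>j. a (Suc j) * b' i - a' i * b (Suc j)) * (\<Prod>j<Suc m. \<kappa> j) =
      (\<Prod>j<Suc m. \<Prod>i\<le>j. a j * b' i - a' i * b j)"
  proof -
    \<comment> \<open>The shifted product covers the pairs \<open>i < j\<close>; the factors
      \<open>\<kappa> j\<close> supply the diagonal \<open>i = j\<close>.\<close>
    have "(\<Prod>i\<le>j. a j * b' i - a' i * b j) = (\<Prod>i<j. a j * b' i - a' i * b j) * \<kappa> j" for j
      by (simp only: lessThan_Suc_atMost [symmetric] prod.lessThan_Suc \<kappa>_def)
    moreover have "(\<Prod>j<m. \<Prod>i\<le>j. a (Suc j) * b' i - a' i * b (Suc j)) =
        (\<Prod>j<Suc m. \<Prod>i<j. a j * b' i - a' i * b j)"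
      by (simp only: prod.lessThan_Suc_shift lessThan_Suc_atMost [symmetric]) simp
    ultimately show ?thesis by (simp only: prod.distrib)
  qed
  finally show ?case
    by (simp only: G_def F_def L_def M_def)
qed

lemma det_linear_forms:
  fixes x y a b a' b' :: "nat \<Rightarrow> 'a::idom"
  shows "det (mat (Suc m) (Suc m) (\<lambda>(i, j).
      (\<Prod>f = j..<m. x i * a f + y i * b f) * (\<Prod>g<j. x i * a' g + y i * b' g))) =
    (\<Prod>j\<le>m. \<Prod>i<j. x i * y j - x j * y i) * (\<Prod>j<m. \<Prod>i\<le>j. a j * b' i - a' i * b j)"
    (is "det ?A = ?rhs")
proof -
  interpret ev: comm_ring_hom "\<lambda>p :: 'a poly. poly p 0"
    by unfold_locales auto
  \<comment> \<open>Adding an indeterminate \<open>t\<close> to \<open>x i\<close> and \<open>a' g\<close> makes every \<open>M\<^sub>g(x\<^sub>i, y\<^sub>i)\<close> monic in \<open>t\<close>,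
    hence nonzero; the identity is then specialised to \<open>t = 0\<close>.\<close>
  let ?x = "\<lambda>i. [:x i, 1:]" and ?y = "\<lambda>i. [:y i:]" and ?a = "\<lambda>f. [:a f:]" and ?b = "\<lambda>f. [:b f:]"
    and ?a' = "\<lambda>g. [:a' g, 1:]" and ?b' = "\<lambda>g. [:b' g:]"
  let ?B = "mat (Suc m) (Suc m) (\<lambda>(i, j).
      (\<Prod>f = j..<m. ?x i * ?a f + ?y i * ?b f) * (\<Prod>g<j. ?x i * ?a' g + ?y i * ?b' g))"
  have "?A = map_mat (\<lambda>p. poly p 0) ?B"
    by (rule eq_matI) (auto simp: poly_prod mult.commute)
  then have "det ?A = poly (det ?B) 0"
    by (simp only: ev.hom_det)
  also have "det ?B = (\<Prod>j\<le>m. \<Prod>i<j. ?x i * ?y j - ?x j * ?y i) *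
      (\<Prod>j<m. \<Prod>i\<le>j. ?a j * ?b' i - ?a' i * ?b j)"
    by (rule det_linear_forms_generic) simp
  also have "poly \<dots> 0 = ?rhs"
    by (simp add: poly_prod mult.commute)
  finally show ?thesis .
qed

section \<open>Exponents and multiplicities in the product over pairs of rows\<close>

text \<open>There are \<open>(m + 1) choose 2\<close> pairs \<open>i < j \<le> m\<close>, their
  \<open>i\<close> sum to \<open>(m + 1) choose 3\<close>, and the difference
  \<open>l = j - i\<close> occurs \<open>m + 1 - l\<close> times; the induction adds the pairs with
  the new largest \<open>j\<close>.\<close>

lemma prod_casorati_factors:
  fixes U :: "int \<Rightarrow> real poly" and D :: "real poly" and c :: real
  assumes "c \<noteq> 0"
  shows "(\<Prod>j\<le>m. \<Prod>i<j. D * [:(- c) powi (s + k * (n + int i)):] * U (k * (int j - int i))) =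
    D ^ ((m + 1) choose 2)
      * [:(- c) powi ((s + k * n) * int ((m + 1) choose 2) + k * int ((m + 1) choose 3)):]
      * (\<Prod>l = 1..m. U (k * int l) ^ (m + 1 - l))"
proof (induction m)
  case 0
  then show ?case by (simp add: one_pCons numeral_2_eq_2 numeral_3_eq_3)
next
  case (Suc m)
  have powi: "(\<Prod>i<j. [:(- c) powi (s + k * (n + int i)):]) =
      [:(- c) powi ((s + k * n) * int j + k * int (j choose 2)):]" for j
  proof (induction j)
    case (Suc j)
    have "(s + k * n) * int (Suc j) + k * int (Suc j choose 2) =
        ((s + k * n) * int j + k * int (j choose 2)) + (s + k * (n + int j))"
      by (simp add: numeral_2_eq_2 algebra_simps)
    then show ?case
      using assms Suc by (simp only: prod.lessThan_Suc) (simp add: power_int_add)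
  qed (simp add: one_pCons numeral_2_eq_2)
  have U1: "(\<Prod>i<j. U (k * (int j - int i))) = (\<Prod>l = 1..j. U (k * int l))" for j
    by (rule prod.reindex_bij_witness[of _ "\<lambda>l. j - l" "\<lambda>i. j - i"]) (auto simp: of_nat_diff)
  \<comment> \<open>At \<open>l = Suc m\<close> the exponent \<open>m + 1 - l\<close> is 0, so the
    old product may run up to \<open>Suc m\<close>.\<close>
  have "(\<Prod>l = 1..Suc m. U (k * int l) ^ (Suc m + 1 - l)) =
      (\<Prod>l = 1..Suc m. U (k * int l) ^ (m + 1 - l) * U (k * int l))"
    by (rule prod.cong) (auto simp: Suc_diff_le mult.commute simp flip: power_Suc)
  also have "\<dots> = (\<Prod>l = 1..m. U (k * int l) ^ (m + 1 - l)) * (\<Prod>l = 1..Suc m. U (k * int l))"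
    by (simp add: prod.distrib)
  finally have U2: "(\<Prod>l = 1..Suc m. U (k * int l) ^ (Suc m + 1 - l)) = \<dots>" .
  have ch: "(Suc m + 1) choose 2 = (m + 1 choose 2) + Suc m"
    "(Suc m + 1) choose 3 = (m + 1 choose 3) + (Suc m choose 2)"
    by (simp_all add: numeral_2_eq_2 numeral_3_eq_3)
  have e: "(s + k * n) * int ((Suc m + 1) choose 2) + k * int ((Suc m + 1) choose 3) =
      ((s + k * n) * int ((m + 1) choose 2) + k * int ((m + 1) choose 3)) +
      ((s + k * n) * int (Suc m) + k * int (Suc m choose 2))"
    unfolding ch by (simp add: algebra_simps)
  have powi_Suc: "[:(- c) powi ((s + k * n) * int ((Suc m + 1) choose 2) + k * int ((Suc m + 1) choose 3)):] =
      [:(- c) powi ((s + k * n) * int ((m + 1) choose 2) + k * int ((m + 1) choose 3)):] *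
      [:(- c) powi ((s + k * n) * int (Suc m) + k * int (Suc m choose 2)):]"
    unfolding e using assms by (subst power_int_add) auto
  have "(\<Prod>j\<le>Suc m. \<Prod>i<j. D * [:(- c) powi (s + k * (n + int i)):] * U (k * (int j - int i))) =
      (\<Prod>j\<le>m. \<Prod>i<j. D * [:(- c) powi (s + k * (n + int i)):] * U (k * (int j - int i))) *
      (D ^ Suc m * (\<Prod>i<Suc m. [:(- c) powi (s + k * (n + int i)):]) *
        (\<Prod>i<Suc m. U (k * (int (Suc m) - int i))))"
    by (simp only: prod.atMost_Suc prod.distrib prod_constant card_lessThan mult_ac)
  also have "\<dots> = D ^ ((Suc m + 1) choose 2)
      * [:(- c) powi ((s + k * n) * int ((Suc m + 1) choose 2) + k * int ((Suc m + 1) choose 3)):]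
      * (\<Prod>l = 1..Suc m. U (k * int l) ^ (Suc m + 1 - l))"
    unfolding Suc.IH powi U1 U2 powi_Suc unfolding ch(1) power_add by (simp only: mult_ac)
  finally show ?case .
qed

section \<open>Specialisation to the sequence \<open>P\<close>\<close>

theorem theorem3:
  fixes s k n :: int and m :: nat
    and p q r a b c :: real
    and P U :: "int \<Rightarrow> real poly"
    and d e :: "nat \<Rightarrow> int"
  assumes "m \<ge> 1"
    and "c \<noteq> 0"
    and "P = poly_seq p q r a b c"
    and "U = poly_seq 0 0 1 a b c"
  shows "det (mat (m + 1) (m + 1) (\<lambda>(i, j).
           (\<Prod>f = j + 1..m. P (s + k * (n + int i + d f))) *
           (\<Prod>g = 1..j. P (s + k * (n + int i + e g)))))
       = (- poly_seq_Delta p q r a b c) ^ ((m + 1) choose 2)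
         * [:(- c) powi ((s + k * n) * int ((m + 1) choose 2) + k * int ((m + 1) choose 3)):]
         * (\<Prod>l = 1..m. U (k * int l) ^ (m + 1 - l))
         * (\<Prod>(i, j) \<in> {(i, j). 1 \<le> i \<and> i \<le> j \<and> j \<le> m}.
              [:(- c) powi (k * d j):] * U (k * (e i - d j)))"
proof -
  note c = assms(2) and P_def = assms(3) and U_def = assms(4)
  define x where "x i = P (s + k * (n + int i))" for i :: nat
  define y where "y i = P (s + k * (n + int i) + 1)" for i :: nat
  \<comment> \<open>\<open>\<alpha> t\<close> and \<open>\<beta> t\<close> are the coefficients in
    the addition formula for the shift \<open>k * t\<close>.\<close>
  define \<alpha> where "\<alpha> t = [:c:] * U (k * t - 1)" for t
  define \<beta> where "\<beta> t = U (k * t)" for t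
  define \<Delta> where "\<Delta> = poly_seq_Delta p q r a b c"
  have lin: "P (s + k * (n + int i + t)) = x i * \<alpha> t + y i * \<beta> t" for i t
    using poly_seq_add[OF c, of p q r a b "s + k * (n + int i)" "k * t"]
    by (simp add: x_def y_def \<alpha>_def \<beta>_def P_def U_def algebra_simps)
  have xy: "x i * y j - x j * y i =
      - \<Delta> * [:(- c) powi (s + k * (n + int i)):] * U (k * (int j - int i))" for i j
    using poly_seq_casorati[OF c, of p q r a b "s + k * (n + int i)" "s + k * (n + int j)"]
    by (simp add: x_def y_def P_def U_def \<Delta>_def algebra_simps)
  \<comment> \<open>The Casorati determinant of \<open>U\<close> itself, whose
    \<open>poly_seq_Delta\<close> is 1, at \<open>k * t - 1\<close> and \<open>k * u - 1\<close>;
    the factor \<open>c\<close> from \<open>\<alpha>\<close> raises the exponent by one and absorbs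
    the sign.\<close>
  have \<alpha>\<beta>: "\<alpha> t * \<beta> u - \<alpha> u * \<beta> t = [:(- c) powi (k * t):] * U (k * (u - t))" for t u
  proof -
    have "poly_seq_Delta 0 0 1 a b c = 1"
      by (simp add: poly_seq_Delta_def one_pCons)
    then have "U (k * t - 1) * U (k * u) - U (k * u - 1) * U (k * t) =
        - [:(- c) powi (k * t - 1):] * U (k * (u - t))"
      using poly_seq_casorati[OF c, of 0 0 1 a b "k * t - 1" "k * u - 1"]
      by (simp add: U_def algebra_simps)
    then have "\<alpha> t * \<beta> u - \<alpha> u * \<beta> t = [:c:] * (- [:(- c) powi (k * t - 1):] * U (k * (u - t)))"
      by (simp only: \<alpha>_def \<beta>_def mult.assoc right_diff_distrib [symmetric])
    also have "\<dots> = ([:- c:] * [:(- c) powi (k * t - 1):]) * U (k * (u - t))"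
      by simp
    also have "[:- c:] * [:(- c) powi (k * t - 1):] = [:(- c) powi (k * t):]"
      using c by (simp add: power_int_diff)
    finally show ?thesis .
  qed
  \<comment> \<open>The theorem counts \<open>d\<close> and \<open>e\<close> from 1, the linear
    forms are counted from 0.\<close>
  have shift: "prod h {j + 1..m} = (\<Prod>f = j..<m. h (Suc f))"
    "prod h {1..j} = (\<Prod>g<j. h (Suc g))" for h :: "nat \<Rightarrow> real poly" and j
    using prod.shift_bounds_Suc_ivl[of h j m] prod.shift_bounds_Suc_ivl[of h 0 j]
    by (simp_all add: atLeastLessThanSuc_atLeastAtMost lessThan_atLeast0)
  have "(\<Prod>j<m. \<Prod>i\<le>j. [:(- c) powi (k * d (Suc j)):] * U (k * (e (Suc i) - d (Suc j)))) =
      (\<Prod>j\<in>{1..m}. \<Prod>i\<in>{1..j}. [:(- c) powi (k * d j):] * U (k * (e i - d j)))"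
    by (simp only: shift lessThan_Suc_atMost)
  also have "\<dots> = (\<Prod>(j, i)\<in>Sigma {1..m} (\<lambda>j. {1..j}). [:(- c) powi (k * d j):] * U (k * (e i - d j)))"
    by (rule prod.Sigma) auto
  also have "\<dots> = (\<Prod>(i, j) \<in> {(i, j). 1 \<le> i \<and> i \<le> j \<and> j \<le> m}.
      [:(- c) powi (k * d j):] * U (k * (e i - d j)))"
    by (rule prod.reindex_bij_witness[of _ prod.swap prod.swap]) auto
  finally have pairs: "(\<Prod>j<m. \<Prod>i\<le>j. \<alpha> (d (Suc j)) * \<beta> (e (Suc i)) - \<alpha> (e (Suc i)) * \<beta> (d (Suc j))) = \<dots>"
    by (simp only: \<alpha>\<beta>)
  have "mat (m + 1) (m + 1) (\<lambda>(i, j).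
      (\<Prod>f = j + 1..m. P (s + k * (n + int i + d f))) * (\<Prod>g = 1..j. P (s + k * (n + int i + e g)))) =
    mat (Suc m) (Suc m) (\<lambda>(i, j).
      (\<Prod>f = j..<m. x i * \<alpha> (d (Suc f)) + y i * \<beta> (d (Suc f))) *
      (\<Prod>g<j. x i * \<alpha> (e (Suc g)) + y i * \<beta> (e (Suc g))))"
    by (simp only: shift lin Suc_eq_plus1)
  then show ?thesis
    by (simp only: det_linear_forms pairs) (simp only: xy prod_casorati_factors[OF c] \<Delta>_def)
qed

end
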